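(* Let $n\ge 1$ and let $o_1,o_2,\dots,o_n$ be odd positive integers forming a cycle of the Collatz-3 map; that is, setting $o_{n+1}=o_1$, for every $i\in\{1,\dots,n\}$ we have $o_{i+1}=(3o_i+1)/2^{k(i)}$, where $2^{k(i)}$ is the largest power of $2$ dividing $3o_i+1$. Then $$\sum_{i=1}^{n}k(i) > n\,\frac{\log 3}{\log 2}.$$
   Context: The Collatz-3 map sends an odd positive integer $x$ to $(3x+1)/2^{k}$, where $k$ is the exponent of the largest power of $2$ dividing $3x+1$. *)

theory Defs
  imports Complex_Main "HOL-Computational_Algebra.Computational_Algebra"
begin

definition collatz3_exp :: "nat \<Rightarrow> nat" where
  "collatz3_exp x = multiplicity 2 (3 * x + 1)"

(* The division is exact: 2 ^ collatz3_exp x divides 3 * x + 1.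
   The map is only meant to be applied to odd x. *)
definition collatz3 :: "nat \<Rightarrow> nat" where
  "collatz3 x = (3 * x + 1) div 2 ^ collatz3_exp x"

end

theory Submission
  imports Defs
begin

text \<open>Clearing denominators, each step reads \<open>x (i + 1) * 2 ^ k i = 3 * x i + 1\<close>.
  Composing the n steps gives \<open>collatz3_orbit_lower_bound\<close>: without the
  \<open>+ 1\<close> terms the two sides would be \<open>3 ^ n * x 1\<close> and
  \<open>x (n + 1) * 2 ^ S\<close>, with S the sum of the exponents, and each \<open>+ 1\<close>
  adds at least 1 to the latter. On a cycle the end values agree and cancel, leaving 3^n < 2^S; take
  logarithms.\<close>

lemma collatz3_mult_power:
  "collatz3 x * 2 ^ collatz3_exp x = 3 * x + 1"
  unfolding collatz3_def collatz3_exp_def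
  by (simp add: multiplicity_dvd)

text \<open>The orbit need not close up here, so induction on its length applies. The
  \<open>+ 1\<close> of each step is later multiplied only by powers of 2 and 3, hence contributes
  at least 1.\<close>

lemma collatz3_orbit_lower_bound:
  fixes x k :: "nat \<Rightarrow> nat"
  assumes "\<And>i. i \<in> {1..n} \<Longrightarrow> k i = collatz3_exp (x i)"
    and "\<And>i. i \<in> {1..n} \<Longrightarrow> x (i + 1) = collatz3 (x i)"
  shows "3 ^ n * x 1 + n \<le> x (n + 1) * 2 ^ (\<Sum>i=1..n. k i)"
  using assms
proof (induction n)
  case 0
  then show ?case by simp
next
  case (Suc n)
  define P :: nat where "P = 2 ^ (\<Sum>i=1..n. k i)"
  have IH: "3 ^ n * x 1 + n \<le> x (n + 1) * P"
    unfolding P_def using Suc by simp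
  have "P \<ge> 1"
    by (simp add: P_def)
  have step: "x (Suc n + 1) * 2 ^ k (Suc n) = 3 * x (n + 1) + 1"
    using Suc.prems[of "Suc n"] collatz3_mult_power[of "x (Suc n)"] by simp
  have "3 ^ Suc n * x 1 + Suc n \<le> 3 * (3 ^ n * x 1 + n) + 1"
    by simp
  \<comment> \<open>The new \<open>+ 1\<close> is enlarged to \<open>P\<close> so that
    \<open>P\<close> factors out.\<close>
  also have "\<dots> \<le> 3 * (x (n + 1) * P) + P"
    using IH \<open>P \<ge> 1\<close> by (intro add_mono mult_le_mono2)
  also have "\<dots> = (x (Suc n + 1) * 2 ^ k (Suc n)) * P"
    unfolding step by (simp add: algebra_simps)
  also have "\<dots> = x (Suc n + 1) * 2 ^ (\<Sum>i=1..Suc n. k i)"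
    by (simp add: P_def power_add)
  finally show ?case .
qed

theorem mainTheorem1:
  fixes n :: nat and x k :: "nat \<Rightarrow> nat"
  assumes "n \<ge> 1"
    and "\<And>i. i \<in> {1..n} \<Longrightarrow> odd (x i)"
    and "x (n + 1) = x 1"
    and "\<And>i. i \<in> {1..n} \<Longrightarrow> k i = collatz3_exp (x i)"
    and "\<And>i. i \<in> {1..n} \<Longrightarrow> x (i + 1) = collatz3 (x i)"
  shows "real (\<Sum>i=1..n. k i) > real n * (ln 3 / ln 2)"
proof -
  define S where "S = (\<Sum>i=1..n. k i)"
  have "3 ^ n * x 1 < x 1 * 2 ^ S"
    using collatz3_orbit_lower_bound[of n k x, OF assms(4,5)] assms(1)
    unfolding assms(3) S_def by linarith
  \<comment> \<open>Strictness forces \<open>x 1\<close> to be positive, so it cancels.\<close>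
  then have "(3::nat) ^ n < 2 ^ S"
    by (simp add: mult.commute)
  then have "real (3 ^ n) < real (2 ^ S)"
    by (simp only: of_nat_less_iff)
  then have "ln ((3::real) ^ n) < ln (2 ^ S)"
    by simp
  then have "real n * ln 3 < real S * ln 2"
    by (simp add: ln_realpow)
  then show ?thesis
    by (simp add: S_def field_simps)
qed

end
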